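(* For every bracket signature $[[a_0;\dots;a_r]]$ there is exactly one proper bracket with that signature.
   Context: A bracket on $n\ge 1$ teams is a full binary tree (every internal node has exactly two children, children are unordered) whose $n$ leaves, called starting lines, are labelled bijectively by the seeds $1,\dots,n$. Brackets that differ only by the way they are drawn (exchanging left and right children) are the same bracket. Team $t_i$ (the $i$-seed) begins at the leaf labelled $i$. Each internal node is a game between the teams arriving from its two children; the winner moves up to that node and the loser plays no more games; the team reaching the root is the champion. If the tree has height $r$, the bracket has $r$ rounds: the games at distance $d$ from the root form round $r-d$. A team has a bye in round $s$ if it plays no game in round $s$ or before; so a team whose leaf is at distance $d$ from the root has exactly $r-d$ byes. The signature of an $r$-round bracket is the list $[[a_0;\dots;a_r]]$, where $a_i$ is the number of teams that get exactly $i$ byes. A bracket signature is a list that is the signature of some bracket. Smaller numbers are higher seeds. A bracket goes chalk if the higher-seeded team (smaller number) wins every game. A bracket is proper if, when it goes chalk, in every round it is better to be a higher-seeded than a lower-seeded team, where (a) it is better to have a bye than to play a game, and (b) it is better to play a lower seed than a higher seed. Explicitly: for every round $s$ and all $i<j$ such that $t_i$ and $t_j$ have not lost before round $s$ when the bracket goes chalk: if $t_j$ has a bye in round $s$ then so does $t_i$; and if both play in round $s$, then the opponent of $t_i$ has a larger seed number than the opponent of $t_j$. *)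

theory Defs
  imports "HOL-Library.Multiset" "HOL-Library.Uprod"
begin

section \<open>Brackets\<close>

text \<open>Full binary trees with unordered children: swapping the two children of a node
  gives an equal tree.\<close>

datatype btree = Leaf nat | Game "btree uprod"

lift_definition plus_commute :: "('a::ab_semigroup_add, 'a) commute" is "(+)"
  by (simp add: add.commute)

primrec leaves :: "btree \<Rightarrow> nat multiset" where
  "leaves (Leaf i) = {#i#}"
| "leaves (Game p) = case_uprod plus_commute (map_uprod leaves p)"

primrec height :: "btree \<Rightarrow> nat" where
  "height (Leaf i) = 0"
| "height (Game p) = Suc (Max (set_uprod (map_uprod height p)))"

definition bracket_on :: "nat \<Rightarrow> btree \<Rightarrow> bool" where
  "bracket_on n t \<longleftrightarrow> n \<ge> 1 \<and> leaves t = mset_set {1..n}"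

definition is_bracket :: "btree \<Rightarrow> bool" where
  "is_bracket t \<longleftrightarrow> (\<exists>n. bracket_on n t)"

text \<open>The nodes at distance \<open>d\<close> from the root, each given as the subtree rooted at it;
  in a bracket distinct nodes carry distinct subtrees, since the labels are distinct.\<close>

fun nodes_at :: "nat \<Rightarrow> btree \<Rightarrow> btree set" where
  "nodes_at 0 t = {t}"
| "nodes_at (Suc d) (Leaf i) = {}"
| "nodes_at (Suc d) (Game p) = (\<Union>c\<in>set_uprod p. nodes_at d c)"


section \<open>Playing a bracket\<close>

text \<open>An outcome assigns to every pair of teams the one that wins their game. Teams are
  identified with their seeds.\<close>

type_synonym outcome = "nat uprod \<Rightarrow> nat"

definition valid_outcome :: "outcome \<Rightarrow> bool" where
  "valid_outcome w \<longleftrightarrow> (\<forall>p. w p \<in> set_uprod p)"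

definition chalk :: outcome where
  "chalk p = Min (set_uprod p)"

primrec champion :: "outcome \<Rightarrow> btree \<Rightarrow> nat" where
  "champion w (Leaf i) = i"
| "champion w (Game p) = w (map_uprod (champion w) p)"

text \<open>Teams \<open>i\<close> and \<open>j\<close> play each other in round \<open>s\<close>; the rounds are \<open>1, ..., height t\<close>.\<close>

definition meets :: "outcome \<Rightarrow> btree \<Rightarrow> nat \<Rightarrow> nat \<Rightarrow> nat \<Rightarrow> bool" where
  "meets w t s i j \<longleftrightarrow>
     (\<exists>d p. Game p \<in> nodes_at d t \<and> s + d = height t \<and> map_uprod (champion w) p = Upair i j)"

definition plays :: "outcome \<Rightarrow> btree \<Rightarrow> nat \<Rightarrow> nat \<Rightarrow> bool" where
  "plays w t s i \<longleftrightarrow> (\<exists>j. meets w t s i j)"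

definition has_bye :: "outcome \<Rightarrow> btree \<Rightarrow> nat \<Rightarrow> nat \<Rightarrow> bool" where
  "has_bye w t s i \<longleftrightarrow> (\<forall>s'\<le>s. \<not> plays w t s' i)"

definition lost_before :: "outcome \<Rightarrow> btree \<Rightarrow> nat \<Rightarrow> nat \<Rightarrow> bool" where
  "lost_before w t s i \<longleftrightarrow> (\<exists>s'<s. \<exists>j. meets w t s' i j \<and> w (Upair i j) \<noteq> i)"

definition byes :: "outcome \<Rightarrow> btree \<Rightarrow> nat \<Rightarrow> nat" where
  "byes w t i = card {s \<in> {1..height t}. has_bye w t s i}"


section \<open>Signatures and proper brackets\<close>

text \<open>The outcome used to count byes is irrelevant, see \<open>byes_eq\<close> and
  \<open>byes_outcome_irrelevant\<close> below.\<close>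

definition signature :: "btree \<Rightarrow> nat list" where
  "signature t =
     map (\<lambda>k. card {i \<in> set_mset (leaves t). byes chalk t i = k}) [0..<Suc (height t)]"

definition bracket_signature :: "nat list \<Rightarrow> bool" where
  "bracket_signature a \<longleftrightarrow> (\<exists>t. is_bracket t \<and> signature t = a)"

definition proper :: "btree \<Rightarrow> bool" where
  "proper t \<longleftrightarrow>
     (\<forall>s\<in>{1..height t}. \<forall>i\<in>#leaves t. \<forall>j\<in>#leaves t.
        i < j \<and> \<not> lost_before chalk t s i \<and> \<not> lost_before chalk t s j \<longrightarrow>
          (has_bye chalk t s j \<longrightarrow> has_bye chalk t s i) \<and>
          (\<forall>i' j'. meets chalk t s i i' \<and> meets chalk t s j j' \<longrightarrow> i' > j'))"


section \<open>Byes are determined by the distance of the starting line from the root\<close>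

declare plus_commute.rep_eq [simp]

lemma leaves_Upair: "leaves (Game (Upair a b)) = leaves a + leaves b"
  by simp

lemma height_Upair: "height (Game (Upair a b)) = Suc (max (height a) (height b))"
  by simp

lemma valid_outcome_chalk: "valid_outcome chalk"
proof -
  have "chalk p \<in> set_uprod p" for p
    by (cases p) (simp add: chalk_def min_def)
  then show ?thesis
    by (simp add: valid_outcome_def)
qed

lemma btree_induct [case_names Leaf Game]:
  assumes "\<And>i. P (Leaf i)" "\<And>a b. P a \<Longrightarrow> P b \<Longrightarrow> P (Game (Upair a b))"
  shows "P t"
proof (induction t)
  case (Game p)
  then show ?case
    using assms(2) by (cases p) auto
qed (rule assms(1))

lemma champion_in_leaves:
  assumes "valid_outcome w"
  shows "champion w t \<in># leaves t"
proof (induction t rule: btree_induct)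
  case (Game a b)
  have "w (Upair (champion w a) (champion w b)) \<in> {champion w a, champion w b}"
    using assms by (metis valid_outcome_def set_uprod_simps)
  then show ?case
    using Game by auto
qed simp

lemma leaf_at_imp_in_leaves: "Leaf i \<in> nodes_at d t \<Longrightarrow> i \<in># leaves t"
proof (induction t arbitrary: d rule: btree_induct)
  case (Leaf j)
  then show ?case by (cases d) auto
next
  case (Game a b)
  then show ?case by (cases d) auto
qed

lemma in_leaves_imp_leaf_at: "i \<in># leaves t \<Longrightarrow> \<exists>d. Leaf i \<in> nodes_at d t"
proof (induction t rule: btree_induct)
  case (Leaf j)
  then show ?case by (auto intro: exI[of _ 0])
next
  case (Game a b)
  then consider d where "Leaf i \<in> nodes_at d a" | d where "Leaf i \<in> nodes_at d b"
    by auto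
  then have "\<exists>d. Leaf i \<in> nodes_at (Suc d) (Game (Upair a b))"
    by cases auto
  then show ?case by blast
qed

lemma leaf_depth_unique:
  assumes "count (leaves t) i \<le> 1" "Leaf i \<in> nodes_at d t" "Leaf i \<in> nodes_at e t"
  shows "d = e"
  using assms
proof (induction t arbitrary: d e rule: btree_induct)
  case (Leaf j)
  then show ?case by (cases d; cases e) auto
next
  case (Game a b)
  obtain d' e' where [simp]: "d = Suc d'" "e = Suc e'"
    using Game.prems by (cases d; cases e) auto
  have cnt: "count (leaves a) i + count (leaves b) i \<le> 1"
    using Game.prems(1) by simp
  then have "\<not> (i \<in># leaves a \<and> i \<in># leaves b)"
    by (auto simp flip: count_greater_zero_iff)
  then have "Leaf i \<in> nodes_at d' a \<and> Leaf i \<in> nodes_at e' a \<or>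
             Leaf i \<in> nodes_at d' b \<and> Leaf i \<in> nodes_at e' b"
    using Game.prems leaf_at_imp_in_leaves by auto
  then show ?case
    using Game.IH cnt by auto
qed

lemma nodes_at_add: "u \<in> nodes_at d t \<Longrightarrow> v \<in> nodes_at e u \<Longrightarrow> v \<in> nodes_at (d + e) t"
proof (induction d t rule: nodes_at.induct)
  case (3 d p)
  then show ?case by auto
qed auto

lemma nodes_at_SucE:
  assumes "v \<in> nodes_at (Suc d) t"
  obtains p where "Game p \<in> nodes_at d t" "v \<in> set_uprod p"
proof -
  have "\<exists>p. Game p \<in> nodes_at d t \<and> v \<in> set_uprod p"
    using assms
  proof (induction d t rule: nodes_at.induct)
    case (1 t)
    then show ?case by (cases t) auto
  next
    case (3 d p)
    then obtain c where c: "c \<in> set_uprod p" "v \<in> nodes_at (Suc d) c"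
      by (simp only: nodes_at.simps(3)) blast
    with 3(1)[OF c(1)] show ?case by fastforce
  qed auto
  then show ?thesis
    using that by blast
qed

lemma nodes_at_height: "u \<in> nodes_at d t \<Longrightarrow> d + height u \<le> height t"
proof (induction t arbitrary: d rule: btree_induct)
  case (Leaf j)
  then show ?case by (cases d) auto
next
  case (Game a b)
  show ?case
  proof (cases d)
    case 0
    with Game.prems show ?thesis by simp
  next
    case (Suc d')
    then have "u \<in> nodes_at d' a \<or> u \<in> nodes_at d' b"
      using Game.prems by auto
    then have "d' + height u \<le> max (height a) (height b)"
      using Game.IH by (auto simp: le_max_iff_disj)
    then show ?thesis
      using Suc by simp
  qed
qed

lemma count_leaves_bracket:
  assumes "is_bracket t"
  shows "count (leaves t) i \<le> 1"
  using assms by (auto simp: is_bracket_def bracket_on_def count_mset_set')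

lemma has_bye_iff:
  assumes t: "is_bracket t" and w: "valid_outcome w" and leaf: "Leaf i \<in> nodes_at d t"
    and s: "s \<le> height t"
  shows "has_bye w t s i \<longleftrightarrow> s \<le> height t - d"
proof
  assume bye: "has_bye w t s i"
  show "s \<le> height t - d"
  proof (cases d)
    case (Suc e)
    from leaf obtain p where p: "Game p \<in> nodes_at e t" "Leaf i \<in> set_uprod p"
      unfolding Suc by (rule nodes_at_SucE)
    obtain c where "p = Upair (Leaf i) c"
      using p(2) by (cases p) auto
    then have "map_uprod (champion w) p = Upair i (champion w c)" by simp
    moreover have "e \<le> height t"
      using nodes_at_height[OF p(1)] by simp
    ultimately have "plays w t (height t - e) i"
      using p(1) unfolding plays_def meets_def by (metis le_add_diff_inverse2)
    then have "\<not> height t - e \<le> s"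
      using bye by (auto simp: has_bye_def)
    then show ?thesis using Suc by linarith
  qed (use s in simp)
next
  assume le: "s \<le> height t - d"
  show "has_bye w t s i"
    unfolding has_bye_def
  proof (intro allI impI notI)
    fix s' assume s': "s' \<le> s" "plays w t s' i"
    then obtain e p j where p: "Game p \<in> nodes_at e t" "s' + e = height t"
        "map_uprod (champion w) p = Upair i j"
      by (auto simp: plays_def meets_def)
    have "i \<in> set_uprod (map_uprod (champion w) p)" by (simp add: p(3))
    then obtain c where c: "c \<in> set_uprod p" "champion w c = i"
      by (cases p) auto
    with champion_in_leaves[OF w, of c] obtain d' where "Leaf i \<in> nodes_at d' c"
      using in_leaves_imp_leaf_at by blast
    with c have "Leaf i \<in> nodes_at (Suc d') (Game p)" by auto
    with p(1) have "Leaf i \<in> nodes_at (e + Suc d') t" by (rule nodes_at_add)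
    then have "d = e + Suc d'"
      using leaf_depth_unique[OF count_leaves_bracket[OF t]] leaf by blast
    moreover have "d \<le> height t"
      using nodes_at_height[OF leaf] by simp
    ultimately show False using le s'(1) p(2) by linarith
  qed
qed

lemma byes_eq:
  assumes "is_bracket t" "valid_outcome w" "Leaf i \<in> nodes_at d t"
  shows "byes w t i = height t - d"
proof -
  have "{s \<in> {1..height t}. has_bye w t s i} = {1..height t - d}"
    using has_bye_iff[OF assms] by fastforce
  then show ?thesis by (simp add: byes_def)
qed

lemma byes_outcome_irrelevant:
  assumes "is_bracket t" "valid_outcome w" "i \<in># leaves t"
  shows "byes w t i = byes chalk t i"
  using in_leaves_imp_leaf_at[OF assms(3)] byes_eq[OF assms(1)] assms(2) valid_outcome_chalk
  by auto

end

theory Submission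
  imports Defs
begin

text \<open>The first round of a bracket on \<open>n\<close> teams can be peeled off. Let \<open>2 * k > 0\<close> teams play
  in it. In a proper bracket these are the \<open>2 * k\<close> lowest seeds, and since the opponent map is
  strictly decreasing on them, it reverses their order: \<open>i\<close> meets \<open>2 * N + 1 - i\<close>,
  where \<open>N = n - k\<close>. So the bracket arises from a bracket on \<open>N\<close> teams by replacing the \<open>k\<close>
  lowest starting lines, all of them at maximal depth, by these games. This replacement
  preserves and reflects properness, and it changes the signature \<open>(y + k) # zs\<close>
  into \<open>2 * k # y # zs\<close>. Induction on the length of the signature gives the theorem. The lists
  that occur are controlled by the Kraft identity \<open>(\<Sum>i\<le>r. a ! i * 2 ^ i) = 2 ^ r\<close>,
  which forces the first entry to be even.\<close>

section \<open>Starting lines at a given depth\<close>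

text \<open>Depth is used instead of the number of byes because it passes to subtrees: a starting
  line of a child lies exactly one level deeper in the whole tree. \<open>signature_eq\<close>
  translates back.\<close>

definition leaves_at :: "nat \<Rightarrow> btree \<Rightarrow> nat set" where
  "leaves_at d t = {i. Leaf i \<in> nodes_at d t}"

lemma leaves_at_simps [simp]:
  "leaves_at 0 (Leaf i) = {i}"
  "leaves_at (Suc d) (Leaf i) = {}"
  "leaves_at 0 (Game p) = {}"
  "leaves_at (Suc d) (Game (Upair a b)) = leaves_at d a \<union> leaves_at d b"
  by (auto simp: leaves_at_def)

lemma leaves_at_subset: "leaves_at d t \<subseteq> set_mset (leaves t)"
  using leaf_at_imp_in_leaves by (auto simp: leaves_at_def)

lemma finite_leaves_at [simp]: "finite (leaves_at d t)"
  using finite_subset[OF leaves_at_subset] by blast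

lemma leaves_at_height_nonempty: "leaves_at (height t) t \<noteq> {}"
proof (induction t rule: btree_induct)
  case (Game a b)
  then show ?case by (cases "height a \<le> height b") (auto simp: max_def)
qed simp

lemma height_eq_0_iff: "height t = 0 \<longleftrightarrow> (\<exists>i. t = Leaf i)"
  by (cases t) auto

lemma bracket_on_imp_is_bracket: "bracket_on n t \<Longrightarrow> is_bracket t"
  by (auto simp: is_bracket_def)

lemma in_leaves_bracket_on: "bracket_on n t \<Longrightarrow> i \<in># leaves t \<longleftrightarrow> 1 \<le> i \<and> i \<le> n"
  by (simp add: bracket_on_def)

lemma bracket_on_unique: "bracket_on n t \<Longrightarrow> bracket_on n' t \<Longrightarrow> n = n'"
  by (metis bracket_on_def card_atLeastAtMost diff_Suc_1 size_mset_set)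

lemma leaves_at_unique:
  "is_bracket t \<Longrightarrow> i \<in> leaves_at d t \<Longrightarrow> i \<in> leaves_at e t \<Longrightarrow> d = e"
  using leaf_depth_unique[OF count_leaves_bracket] by (simp add: leaves_at_def)

lemma leaves_nodes_at: "u \<in> nodes_at d t \<Longrightarrow> leaves u \<subseteq># leaves t"
proof (induction t arbitrary: d rule: btree_induct)
  case (Leaf i)
  then show ?case by (cases d) auto
next
  case (Game a b)
  show ?case
  proof (cases d)
    case (Suc e)
    then have "leaves u \<subseteq># leaves a \<or> leaves u \<subseteq># leaves b"
      using Game.prems Game.IH by auto
    then show ?thesis
      by (auto intro: subset_mset.add_increasing subset_mset.add_increasing2)
  qed (use Game.prems in simp)
qed

lemma signature_eq:
  assumes "is_bracket t"
  shows "signature t = map (\<lambda>k. card (leaves_at (height t - k) t)) [0..<Suc (height t)]"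
proof -
  have "{i \<in> set_mset (leaves t). byes chalk t i = k} = leaves_at (height t - k) t"
    if k: "k \<le> height t" for k
  proof (intro set_eqI iffI)
    fix i assume i: "i \<in> {i \<in> set_mset (leaves t). byes chalk t i = k}"
    then obtain d where d: "Leaf i \<in> nodes_at d t"
      using in_leaves_imp_leaf_at by auto
    then have "d \<le> height t" "byes chalk t i = height t - d"
      using nodes_at_height[OF d] byes_eq[OF assms valid_outcome_chalk d] by auto
    \<comment> \<open>The bound on \<open>d\<close> makes the truncated subtraction
      reversible.\<close>
    then have "height t - byes chalk t i = d" by simp
    with i d show "i \<in> leaves_at (height t - k) t"
      by (auto simp: leaves_at_def)
  next
    fix i assume "i \<in> leaves_at (height t - k) t"
    then have "Leaf i \<in> nodes_at (height t - k) t" by (simp add: leaves_at_def)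
    then show "i \<in> {i \<in> set_mset (leaves t). byes chalk t i = k}"
      using byes_eq[OF assms valid_outcome_chalk] leaf_at_imp_in_leaves k by auto
  qed
  then show ?thesis unfolding signature_def by (intro map_cong) auto
qed

section \<open>Length, head and Kraft sum of a signature\<close>

lemma length_signature: "length (signature t) = Suc (height t)"
  by (simp add: signature_def)

lemma hd_signature: "is_bracket t \<Longrightarrow> hd (signature t) = card (leaves_at (height t) t)"
  by (simp add: signature_eq hd_map upt_rec)

text \<open>Each child of a game contributes \<open>2 ^ (h - 1)\<close>. The bound \<open>h\<close>
  is any number at least the height, because the two children may differ in height while the
  induction needs a common bound.\<close>

lemma kraft:
  assumes "\<And>i. count (leaves t) i \<le> 1" "height t \<le> h"
  shows "(\<Sum>d\<le>h. card (leaves_at d t) * 2 ^ (h - d)) = 2 ^ h"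
  using assms
proof (induction t arbitrary: h rule: btree_induct)
  case (Leaf i)
  then show ?case by (cases h) (simp_all add: sum.atMost_Suc_shift del: sum.atMost_Suc)
next
  case (Game a b)
  then obtain h' where h: "h = Suc h'" "height a \<le> h'" "height b \<le> h'"
    by (cases h) auto
  have cnt: "count (leaves a) i + count (leaves b) i \<le> 1" for i
    using Game.prems(1)[of i] by simp
  \<comment> \<open>A label occurs only once, so the children share no starting line and their
    cardinalities add at each depth.\<close>
  have "set_mset (leaves a) \<inter> set_mset (leaves b) = {}"
  proof (rule ccontr)
    assume "set_mset (leaves a) \<inter> set_mset (leaves b) \<noteq> {}"
    then obtain i where "i \<in># leaves a" "i \<in># leaves b" by auto
    with cnt[of i] show False by (simp flip: count_greater_zero_iff)
  qed
  then have "leaves_at d a \<inter> leaves_at d b = {}" for d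
    using leaves_at_subset by blast
  then have "card (leaves_at (Suc d) (Game (Upair a b)))
      = card (leaves_at d a) + card (leaves_at d b)" for d
    by (simp add: card_Un_disjoint)
  moreover have "(\<Sum>d\<le>h'. card (leaves_at d a) * 2 ^ (h' - d)) = 2 ^ h'"
    using cnt h(2) by (intro Game.IH(1)) (meson add_leE)+
  moreover have "(\<Sum>d\<le>h'. card (leaves_at d b) * 2 ^ (h' - d)) = 2 ^ h'"
    using cnt h(3) by (intro Game.IH(2)) (meson add_leE)+
  ultimately show ?case
    by (simp add: h(1) sum.atMost_Suc_shift add_mult_distrib sum.distrib
        del: sum.atMost_Suc leaves_at_simps(4))
qed

text \<open>\<open>horner_sum id 2\<close> evaluates the list, read as a polynomial, at 2.
  Substituting \<open>d = height t - k\<close> turns this value into the sum in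
  \<open>kraft\<close>.\<close>

lemma kraft_signature:
  assumes "is_bracket t"
  shows "horner_sum id 2 (signature t) = 2 ^ height t"
proof -
  have "horner_sum id 2 (signature t)
      = (\<Sum>k<Suc (height t). card (leaves_at (height t - k) t) * 2 ^ k)"
    unfolding signature_eq[OF assms] horner_sum_eq_sum
    by (rule sum.cong) (auto simp del: upt_Suc)
  also have "\<dots> = (\<Sum>d\<le>height t. card (leaves_at d t) * 2 ^ (height t - d))"
    unfolding lessThan_Suc_atMost
    by (rule sum.reindex_bij_witness[of _ "\<lambda>d. height t - d" "\<lambda>d. height t - d"]) auto
  also have "\<dots> = 2 ^ height t"
    using kraft[OF count_leaves_bracket[OF assms]] by simp
  finally show ?thesis .
qed


section \<open>Rounds of a bracket\<close>

lemma chalk_Upair [simp]: "chalk (Upair i j) = min i j"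
  by (simp add: chalk_def)

text \<open>Such a game would be a node at depth \<open>height t\<close>, where only leaves
  fit.\<close>

lemma meets_0: "\<not> meets w t 0 i j"
  using nodes_at_height by (fastforce simp: meets_def)

lemma plays_0: "\<not> plays w t 0 i"
  by (simp add: plays_def meets_0)

lemma not_lost_before_1: "\<not> lost_before w t (Suc 0) i"
  by (simp add: lost_before_def meets_0)

lemma has_bye_iff_leaves_at:
  assumes "is_bracket t" "i \<in> leaves_at d t" "s \<le> height t"
  shows "has_bye chalk t s i \<longleftrightarrow> s \<le> height t - d"
  using assms has_bye_iff valid_outcome_chalk by (simp add: leaves_at_def)

text \<open>An upward closed nonempty set is the interval from its minimum to \<open>N\<close>, and
  counting its elements determines the minimum.\<close>

lemma up_closed_eq_interval:
  fixes U :: "nat set"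
  assumes "U \<subseteq> {1..N}" "\<And>i j. i \<in> U \<Longrightarrow> i < j \<Longrightarrow> j \<le> N \<Longrightarrow> j \<in> U"
  shows "U = {N - card U<..N}"
proof (cases "U = {}")
  case False
  have "finite U" using assms(1) finite_subset by blast
  with False have x: "Min U \<in> U" "\<And>i. i \<in> U \<Longrightarrow> Min U \<le> i" by auto
  then have U: "U = {Min U..N}"
  proof (intro equalityI subsetI)
    fix i assume i: "i \<in> {Min U..N}"
    then show "i \<in> U" using assms(2)[OF x(1), of i] x(1) by (cases "i = Min U") auto
  qed (use assms(1) x(2) in auto)
  then have "card U = Suc N - Min U" by (metis card_atLeastAtMost)
  moreover have "1 \<le> Min U" "Min U \<le> N" using x(1) assms(1) by auto
  ultimately have "{N - card U<..N} = {Min U..N}" by auto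
  with U show ?thesis by simp
qed simp

lemma proper_leaves_at_height:
  assumes t: "bracket_on N t" "proper t"
  shows "leaves_at (height t) t = {N - card (leaves_at (height t) t)<..N}"
proof (rule up_closed_eq_interval)
  note b = bracket_on_imp_is_bracket[OF t(1)]
  show "leaves_at (height t) t \<subseteq> {1..N}"
    using leaves_at_subset in_leaves_bracket_on[OF t(1)] by fastforce
  fix i j assume ij: "i \<in> leaves_at (height t) t" "i < j" "j \<le> N"
  have i: "i \<in># leaves t" using ij(1) leaves_at_subset by blast
  then have j: "j \<in># leaves t" using ij in_leaves_bracket_on[OF t(1)] by auto
  then obtain d where d: "j \<in> leaves_at d t"
    using in_leaves_imp_leaf_at by (auto simp: leaves_at_def)
  have le: "d \<le> height t" using d nodes_at_height[of "Leaf j" d t] by (simp add: leaves_at_def)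
  show "j \<in> leaves_at (height t) t"
  \<comment> \<open>If \<open>j\<close> started nearer to the root, it would have a bye in round 1,
    and properness would give \<open>i\<close> one as well, although \<open>i\<close> starts at
    maximal depth.\<close>
  proof (cases "d = height t")
    case False
    with le have h: "Suc 0 \<le> height t" "Suc 0 \<le> height t - d" by auto
    then have "has_bye chalk t (Suc 0) j"
      using has_bye_iff_leaves_at[OF b d] by auto
    then have "has_bye chalk t (Suc 0) i"
      using t(2) i j ij(2) h(1) not_lost_before_1 unfolding proper_def by fastforce
    then show ?thesis
      using has_bye_iff_leaves_at[OF b ij(1)] h(1) by auto
  qed (use d in simp)
qed


section \<open>Adding a first round\<close>

text \<open>Substitution of trees for leaves, that is, the monadic bind of the tree type.\<close>

primrec graft :: "(nat \<Rightarrow> btree) \<Rightarrow> btree \<Rightarrow> btree" where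
  "graft f (Leaf i) = f i"
| "graft f (Game p) = Game (map_uprod (graft f) p)"

text \<open>The seeds of each inserted game add up to \<open>2 * N + 1\<close>, so when it goes
  chalk the winner is \<open>i\<close>, the team that stood on the replaced line.\<close>

definition play_in :: "nat \<Rightarrow> nat \<Rightarrow> nat \<Rightarrow> btree" where
  "play_in m N i =
     (if m < i \<and> i \<le> N then Game (Upair (Leaf i) (Leaf (2 * N + 1 - i))) else Leaf i)"

text \<open>Only a leaf replaced above depth \<open>d\<close> could bring in a node at depth
  \<open>d\<close> that is not the image of an old one.\<close>

lemma nodes_at_graft:
  assumes "\<And>e i. e < d \<Longrightarrow> i \<in> leaves_at e t \<Longrightarrow> f i = Leaf i"
  shows "nodes_at d (graft f t) = graft f ` nodes_at d t"
  using assms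
proof (induction t arbitrary: d rule: btree_induct)
  case (Leaf i)
  show ?case
  proof (cases d)
    case (Suc e)
    with Leaf[of 0 i] show ?thesis by simp
  qed simp
next
  case (Game a b)
  show ?case
  proof (cases d)
    case (Suc e)
    have "f i = Leaf i" if "e' < e" "i \<in> leaves_at e' a \<or> i \<in> leaves_at e' b" for e' i
      using Game.prems[of "Suc e'" i] that Suc by auto
    then show ?thesis using Suc Game.IH[of e] by (simp add: image_Un)
  qed simp
qed

lemma height_graft_le: "(\<And>i. height (f i) \<le> 1) \<Longrightarrow> height (graft f t) \<le> Suc (height t)"
  by (induction t rule: btree_induct) auto

lemma champion_graft: "(\<And>i. champion w (f i) = i) \<Longrightarrow> champion w (graft f t) = champion w t"
  by (induction t rule: btree_induct) auto

lemma champion_play_in [simp]: "champion chalk (play_in m N i) = i"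
  by (auto simp: play_in_def)

lemma height_play_in: "height (play_in m N i) \<le> 1"
  by (simp add: play_in_def)

text \<open>Every line keeps its own label. A new label \<open>x\<close> comes only from the game
  inserted at \<open>2 * N + 1 - x\<close>, and \<open>x \<le> 2 * N - m\<close> says that this seed
  exceeds \<open>m\<close>.\<close>

lemma count_leaves_play_in:
  assumes "m \<le> N"
  shows "count (leaves (graft (play_in m N) t)) x =
    count (leaves t) x + (if N < x \<and> x \<le> 2 * N - m then count (leaves t) (2 * N + 1 - x) else 0)"
proof (induction t rule: btree_induct)
  case (Leaf i)
  show ?case using assms by (auto simp: play_in_def)
qed auto

text \<open>At least one line is replaced, and all replaced lines have maximal depth, so that the
  inserted games form exactly one new round.\<close>

locale first_round =
  fixes b :: btree and m N :: nat
  assumes bracket: "bracket_on N b" and m_less: "m < N"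
    and deep: "{m<..N} \<subseteq> leaves_at (height b) b"
begin

section \<open>Nodes, teams and signature of the enlarged bracket\<close>

abbreviation D :: nat where "D \<equiv> height b"
abbreviation t :: btree where "t \<equiv> graft (play_in m N) b"

lemma is_bracket_b: "is_bracket b"
  using bracket by (rule bracket_on_imp_is_bracket)

lemma play_in_shallow: "e < D \<Longrightarrow> i \<in> leaves_at e b \<Longrightarrow> play_in m N i = Leaf i"
  using leaves_at_unique[OF is_bracket_b, of i e D] deep by (auto simp: play_in_def)

lemma nodes_at_t: "d \<le> D \<Longrightarrow> nodes_at d t = graft (play_in m N) ` nodes_at d b"
  by (rule nodes_at_graft, rule play_in_shallow) (rule less_le_trans)

lemma Game_at_D_iff:
  "Game p \<in> nodes_at D t \<longleftrightarrow>
     (\<exists>i. m < i \<and> i \<le> N \<and> p = Upair (Leaf i) (Leaf (2 * N + 1 - i)))"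
proof
  assume "Game p \<in> nodes_at D t"
  then obtain u where u: "u \<in> nodes_at D b" "Game p = graft (play_in m N) u"
    by (auto simp: nodes_at_t)
  \<comment> \<open>\<open>D\<close> is the full height of \<open>b\<close>, so a node of
    \<open>b\<close> at this depth is a leaf.\<close>
  have "height u = 0" using nodes_at_height[OF u(1)] by simp
  then obtain i where "u = Leaf i" by (auto simp: height_eq_0_iff)
  with u(2) show "\<exists>i. m < i \<and> i \<le> N \<and> p = Upair (Leaf i) (Leaf (2 * N + 1 - i))"
    by (auto simp: play_in_def split: if_splits)
next
  assume "\<exists>i. m < i \<and> i \<le> N \<and> p = Upair (Leaf i) (Leaf (2 * N + 1 - i))"
  then obtain i where i: "m < i" "i \<le> N" "p = Upair (Leaf i) (Leaf (2 * N + 1 - i))" by blast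
  then have "Leaf i \<in> nodes_at D b" using deep by (auto simp: leaves_at_def)
  then have "graft (play_in m N) (Leaf i) \<in> nodes_at D t"
    unfolding nodes_at_t[OF order_refl] by (rule imageI)
  then show "Game p \<in> nodes_at D t" using i by (simp add: play_in_def)
qed

lemma height_t: "height t = Suc D"
proof (rule antisym)
  show "height t \<le> Suc D" using height_graft_le height_play_in by blast
  have "Game (Upair (Leaf N) (Leaf (2 * N + 1 - N))) \<in> nodes_at D t"
    using m_less Game_at_D_iff by blast
  then show "Suc D \<le> height t" using nodes_at_height by fastforce
qed

lemma bracket_on_t: "bracket_on (2 * N - m) t"
proof -
  have "leaves t = mset_set {1..2 * N - m}"
    using bracket m_less
    by (intro multiset_eqI) (auto simp: count_leaves_play_in bracket_on_def count_mset_set')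
  then show ?thesis using m_less by (simp add: bracket_on_def)
qed

lemma is_bracket_t: "is_bracket t"
  using bracket_on_t by (rule bracket_on_imp_is_bracket)

lemma leaves_at_t: "d \<le> D \<Longrightarrow> leaves_at d t = leaves_at d b - {m<..N}"
proof -
  assume d: "d \<le> D"
  have "Leaf i = graft (play_in m N) u \<longleftrightarrow> u = Leaf i \<and> \<not> (m < i \<and> i \<le> N)" for i u
    by (cases u) (auto simp: play_in_def)
  then show ?thesis using nodes_at_t[OF d] by (auto simp: leaves_at_def image_iff)
qed

lemma leaves_at_Suc_D: "leaves_at (Suc D) t = {m<..2 * N - m}"
proof (intro set_eqI iffI)
  fix i assume "i \<in> leaves_at (Suc D) t"
  then have "Leaf i \<in> nodes_at (Suc D) t" by (simp add: leaves_at_def)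
  then obtain p where "Game p \<in> nodes_at D t" "Leaf i \<in> set_uprod p" by (rule nodes_at_SucE)
  then show "i \<in> {m<..2 * N - m}" by (auto simp: Game_at_D_iff)
next
  fix i assume i: "i \<in> {m<..2 * N - m}"
  \<comment> \<open>\<open>j\<close> is the higher seed of the inserted game in which
    \<open>i\<close> plays.\<close>
  define j where "j = (if i \<le> N then i else 2 * N + 1 - i)"
  have j: "m < j" "j \<le> N" "i = j \<or> i = 2 * N + 1 - j"
    using i by (auto simp: j_def)
  then have "Game (Upair (Leaf j) (Leaf (2 * N + 1 - j))) \<in> nodes_at D t"
    using Game_at_D_iff by blast
  from nodes_at_add[OF this, of "Leaf i" "Suc 0"] show "i \<in> leaves_at (Suc D) t"
    using j(3) by (auto simp: leaves_at_def)
qed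

text \<open>The new deepest level holds both players of all \<open>N - m\<close> games, the level
  above loses the replaced lines, and the other levels stay. The second claim makes the subtraction
  exact, so that \<open>signature b\<close> can be recovered.\<close>

lemma signature_t: "signature t = 2 * (N - m) # (hd (signature b) - (N - m)) # tl (signature b)"
  and le_hd_signature: "N - m \<le> hd (signature b)"
proof -
  have "card (leaves_at D t) = card (leaves_at D b) - (N - m)"
    using deep by (simp add: leaves_at_t card_Diff_subset)
  moreover have "leaves_at (D - Suc k) t = leaves_at (D - Suc k) b" if "k < D" for k
  proof -
    have "leaves_at (D - Suc k) b \<inter> {m<..N} = {}"
      using leaves_at_unique[OF is_bracket_b] deep that by fastforce
    then show ?thesis using leaves_at_t[of "D - Suc k"] by auto
  qed
  moreover have "card (leaves_at (Suc D) t) = 2 * (N - m)"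
    using m_less by (simp add: leaves_at_Suc_D)
  moreover have sig: "signature u = card (leaves_at (height u) u) #
      map (\<lambda>k. card (leaves_at (height u - Suc k) u)) [0..<height u]" if "is_bracket u" for u
    unfolding signature_eq[OF that] by (simp del: upt_Suc add: map_upt_Suc)
  ultimately show "signature t = 2 * (N - m) # (hd (signature b) - (N - m)) # tl (signature b)"
    unfolding sig[OF is_bracket_t] sig[OF is_bracket_b] height_t
    by (simp del: upt_Suc add: map_upt_Suc)
  show "N - m \<le> hd (signature b)"
    using card_mono[OF _ deep] hd_signature[OF is_bracket_b] by simp
qed

section \<open>Games, byes and losses of the enlarged bracket, round by round\<close>

lemma meets_1_iff:
  "meets chalk t (Suc 0) i j \<longleftrightarrow> m < i \<and> m < j \<and> i + j = 2 * N + 1"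
proof -
  have "meets chalk t (Suc 0) i j \<longleftrightarrow>
      (\<exists>p. Game p \<in> nodes_at D t \<and> map_uprod (champion chalk) p = Upair i j)"
    by (auto simp: meets_def height_t)
  also have "\<dots> \<longleftrightarrow> (\<exists>k. m < k \<and> k \<le> N \<and> Upair k (2 * N + 1 - k) = Upair i j)"
    unfolding Game_at_D_iff by auto
  also have "\<dots> \<longleftrightarrow> m < i \<and> m < j \<and> i + j = 2 * N + 1"
  proof
    assume "m < i \<and> m < j \<and> i + j = 2 * N + 1"
    then show "\<exists>k. m < k \<and> k \<le> N \<and> Upair k (2 * N + 1 - k) = Upair i j"
      \<comment> \<open>The smaller of two numbers with sum \<open>2 * N + 1\<close> is at most
        \<open>N\<close>.\<close>
      by (intro exI[of _ "min i j"]) (auto simp: min_def)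
  qed auto
  finally show ?thesis .
qed

text \<open>The heights differ by one, so both rounds lie at the same depth, which is less than
  \<open>D\<close>, and grafting changes no chalk champion.\<close>

lemma meets_Suc_iff:
  assumes "s \<ge> 1"
  shows "meets chalk t (Suc s) i j \<longleftrightarrow> meets chalk b s i j"
proof
  assume "meets chalk t (Suc s) i j"
  then obtain d p where p: "Game p \<in> nodes_at d t" "Suc s + d = Suc D"
      "map_uprod (champion chalk) p = Upair i j"
    by (auto simp: meets_def height_t)
  then have d: "d < D" using assms by simp
  with p(1) obtain u where u: "u \<in> nodes_at d b" "Game p = graft (play_in m N) u"
    by (auto simp: nodes_at_t)
  \<comment> \<open>A leaf at depth less than \<open>D\<close> is unchanged by grafting, so it could
    not become a game.\<close>
  obtain q where q: "u = Game q"
  proof (cases u)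
    case (Leaf k)
    with u play_in_shallow[OF d, of k] show ?thesis by (simp add: leaves_at_def)
  qed (use that in simp)
  have "map_uprod (champion chalk) q = Upair i j"
    using p(3) u(2) q by (simp add: uprod.map_comp comp_def champion_graft)
  then show "meets chalk b s i j"
    using u(1) q p(2) by (auto simp: meets_def)
next
  assume "meets chalk b s i j"
  then obtain d p where p: "Game p \<in> nodes_at d b" "s + d = D"
      "map_uprod (champion chalk) p = Upair i j"
    by (auto simp: meets_def)
  have "graft (play_in m N) (Game p) \<in> nodes_at d t"
    using imageI[OF p(1), of "graft (play_in m N)"] p(2) nodes_at_t[of d] by simp
  moreover have "map_uprod (champion chalk) (map_uprod (graft (play_in m N)) p) = Upair i j"
    using p(3) by (simp add: uprod.map_comp comp_def champion_graft)
  ultimately show "meets chalk t (Suc s) i j"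
    unfolding meets_def height_t
    by (intro exI[of _ d] exI[of _ "map_uprod (graft (play_in m N)) p"]) (simp add: p(2))
qed

lemma has_bye_1_iff: "has_bye chalk t (Suc 0) i \<longleftrightarrow> i \<le> m \<or> 2 * N - m < i"
proof -
  have "has_bye chalk t (Suc 0) i \<longleftrightarrow> \<not> plays chalk t (Suc 0) i"
    by (auto simp: has_bye_def plays_0 le_Suc_eq)
  also have "\<dots> \<longleftrightarrow> \<not> (\<exists>j. m < i \<and> m < j \<and> i + j = 2 * N + 1)"
    by (simp add: plays_def meets_1_iff)
  also have "\<dots> \<longleftrightarrow> i \<le> m \<or> 2 * N - m < i"
    using m_less by presburger
  finally show ?thesis .
qed

lemma has_bye_Suc_iff:
  assumes s: "s \<ge> 1" "s \<le> D" and i: "i \<le> N"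
  shows "has_bye chalk t (Suc s) i \<longleftrightarrow> has_bye chalk b s i"
proof -
  have bye: "has_bye chalk u k i \<longleftrightarrow> (\<forall>l<k. \<not> plays chalk u (Suc l) i)" for u k
    unfolding has_bye_def using plays_0 by (metis Suc_le_eq old.nat.exhaust)
  have "has_bye chalk t (Suc s) i \<longleftrightarrow>
      has_bye chalk t (Suc 0) i \<and> (\<forall>l<s. \<not> plays chalk t (Suc (Suc l)) i)"
    by (auto simp: bye All_less_Suc2)
  also have "(\<forall>l<s. \<not> plays chalk t (Suc (Suc l)) i) \<longleftrightarrow> has_bye chalk b s i"
    by (simp add: bye plays_def meets_Suc_iff)
  also have "has_bye chalk t (Suc 0) i \<and> has_bye chalk b s i \<longleftrightarrow> has_bye chalk b s i"
  proof -
    \<comment> \<open>Seeds in \<open>{m<..N}\<close> start at maximal depth in \<open>b\<close>, so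
      they have no bye there; a bye in \<open>b\<close> thus implies a bye in the new round
      1.\<close>
    have "i \<le> m" if "has_bye chalk b s i"
    proof (rule ccontr)
      assume "\<not> i \<le> m"
      with i deep have "i \<in> leaves_at D b" by auto
      from has_bye_iff_leaves_at[OF is_bracket_b this s(2)] that s(1) show False by simp
    qed
    then show ?thesis by (auto simp: has_bye_1_iff)
  qed
  finally show ?thesis .
qed

text \<open>The only additional losses occur in round 1, and there the losers are exactly the new
  seeds, those above \<open>N\<close>.\<close>

lemma lost_before_Suc_iff:
  assumes "s \<ge> 1" "i \<le> 2 * N - m"
  shows "lost_before chalk t (Suc s) i \<longleftrightarrow> N < i \<or> lost_before chalk b s i"
proof -
  obtain k where k: "s = Suc k" using assms(1) by (cases s) auto
  have min: "min i j \<noteq> i \<longleftrightarrow> j < i" for j by auto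
  have lost: "lost_before chalk u (Suc l) i \<longleftrightarrow> (\<exists>e<l. \<exists>j<i. meets chalk u (Suc e) i j)" for u l
    unfolding lost_before_def chalk_Upair min Ex_less_Suc2 using meets_0 by blast
  have "(\<exists>j<i. meets chalk t (Suc 0) i j) \<longleftrightarrow> N < i"
  proof
    assume "N < i"
    then have "2 * N + 1 - i < i" "m < i" "m < 2 * N + 1 - i" "i + (2 * N + 1 - i) = 2 * N + 1"
      using assms(2) m_less by linarith+
    then show "\<exists>j<i. meets chalk t (Suc 0) i j" unfolding meets_1_iff by blast
  next
    assume "\<exists>j<i. meets chalk t (Suc 0) i j"
    then show "N < i" unfolding meets_1_iff by linarith
  qed
  then show ?thesis
    by (simp add: k lost Ex_less_Suc2 meets_Suc_iff)
qed

text \<open>Round 1 is always in order, since its pairing \<open>i \<mapsto> 2 * N + 1 - i\<close>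
  reverses the seeds and the byes go to the seeds up to \<open>m\<close>. Afterwards the seeds above
  \<open>N\<close> are out, and the rest is the condition on \<open>b\<close>, one round
  later.\<close>

lemma proper_iff: "proper t \<longleftrightarrow> proper b"
proof -
  define P where "P u s i j \<longleftrightarrow>
      (i < j \<and> \<not> lost_before chalk u s i \<and> \<not> lost_before chalk u s j \<longrightarrow>
        (has_bye chalk u s j \<longrightarrow> has_bye chalk u s i) \<and>
        (\<forall>i' j'. meets chalk u s i i' \<and> meets chalk u s j j' \<longrightarrow> i' > j'))" for u s i j
  have proper_P: "proper u \<longleftrightarrow> (\<forall>s\<in>{1..height u}. \<forall>i\<in>{1..n}. \<forall>j\<in>{1..n}. P u s i j)"
    if "bracket_on n u" for u n
  proof -
    have "set_mset (leaves u) = {1..n}" using in_leaves_bracket_on[OF that] by (intro set_eqI) simp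
    then show ?thesis by (simp only: proper_def P_def)
  qed
  have round_1: "P t (Suc 0) i j" if "j \<le> 2 * N - m" for i j
    using that by (auto simp: P_def has_bye_1_iff meets_1_iff)
  have later: "P t (Suc s) i j \<longleftrightarrow> (i \<le> N \<and> j \<le> N \<longrightarrow> P b s i j)"
    if s: "s \<in> {1..D}" and j: "j \<le> 2 * N - m" for s i j
  proof (cases "i < j")
    case True
    show ?thesis
    proof (cases "j \<le> N")
      case False
      then have "lost_before chalk t (Suc s) j"
        using s j lost_before_Suc_iff[of s j] by simp
      then show ?thesis using False by (simp add: P_def)
    next
      case le: True
      have "lost_before chalk t (Suc s) k \<longleftrightarrow> lost_before chalk b s k"
        and "has_bye chalk t (Suc s) k \<longleftrightarrow> has_bye chalk b s k" if "k \<le> N" for k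
        using that s m_less by (auto simp: lost_before_Suc_iff has_bye_Suc_iff)
      then show ?thesis
        using le True s by (simp add: P_def meets_Suc_iff)
    qed
  qed (simp add: P_def)
  \<comment> \<open>The rounds of \<open>t\<close> are round 1 and the shifted rounds of
    \<open>b\<close>.\<close>
  have "proper t \<longleftrightarrow> (\<forall>s\<in>insert (Suc 0) (Suc ` {1..D}).
      \<forall>i\<in>{1..2 * N - m}. \<forall>j\<in>{1..2 * N - m}. P t s i j)"
    unfolding proper_P[OF bracket_on_t] height_t
    by (simp add: atLeastAtMost_insertL)
  also have "\<dots> \<longleftrightarrow> (\<forall>s\<in>{1..D}. \<forall>i\<in>{1..2 * N - m}. \<forall>j\<in>{1..2 * N - m}. P t (Suc s) i j)"
    using round_1 by (simp del: image_Suc_atLeastAtMost)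
  also have "\<dots> \<longleftrightarrow> (\<forall>s\<in>{1..D}. \<forall>i\<in>{1..2 * N - m}. \<forall>j\<in>{1..2 * N - m}.
      i \<le> N \<and> j \<le> N \<longrightarrow> P b s i j)"
    by (intro ball_cong refl later) auto
  also have "\<dots> \<longleftrightarrow> (\<forall>s\<in>{1..D}. \<forall>i\<in>{1..N}. \<forall>j\<in>{1..N}. P b s i j)"
  proof -
    have "{1..N} \<subseteq> {1..2 * N - m}" using m_less by auto
    then have "(\<forall>i\<in>{1..2 * N - m}. \<forall>j\<in>{1..2 * N - m}. i \<le> N \<and> j \<le> N \<longrightarrow> P b s i j) \<longleftrightarrow>
        (\<forall>i\<in>{1..N}. \<forall>j\<in>{1..N}. P b s i j)" for s
      by (auto simp: subset_iff)
    then show ?thesis by simp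
  qed
  also have "\<dots> \<longleftrightarrow> proper b"
    using proper_P[OF bracket] by simp
  finally show ?thesis .
qed

end


section \<open>Removing the first round\<close>

text \<open>What remains once all games at depth \<open>d\<close> or more have gone chalk: each
  subtree at depth \<open>d\<close> shrinks to its champion.\<close>

primrec trunc :: "nat \<Rightarrow> btree \<Rightarrow> btree" where
  "trunc 0 t = Leaf (champion chalk t)"
| "trunc (Suc d) t = (case t of Leaf i \<Rightarrow> Leaf i | Game p \<Rightarrow> Game (map_uprod (trunc d) p))"

lemma height_trunc: "height (trunc d t) = min d (height t)"
proof (induction t arbitrary: d rule: btree_induct)
  case (Leaf i)
  show ?case by (cases d) auto
next
  case (Game a b)
  then show ?case by (cases d) auto
qed

lemma champion_in_leaves_at_trunc:
  "u \<in> nodes_at d t \<Longrightarrow> champion chalk u \<in> leaves_at d (trunc d t)"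
proof (induction t arbitrary: d rule: btree_induct)
  case (Leaf i)
  then show ?case by (cases d) auto
next
  case (Game a b)
  then show ?case by (cases d) (auto simp del: champion.simps)
qed

text \<open>Truncation is undone by any \<open>f\<close> that regrows each cut subtree from its
  champion and keeps the shallower leaves.\<close>

lemma graft_trunc:
  assumes "\<And>u. u \<in> nodes_at d t \<Longrightarrow> f (champion chalk u) = u"
    and "\<And>e i. e < d \<Longrightarrow> i \<in> leaves_at e t \<Longrightarrow> f i = Leaf i"
  shows "graft f (trunc d t) = t"
  using assms
proof (induction t arbitrary: d rule: btree_induct)
  case (Leaf i)
  show ?case
  proof (cases d)
    case 0
    with Leaf(1)[of "Leaf i"] show ?thesis by simp
  next
    case (Suc e)
    with Leaf(2)[of 0 i] show ?thesis by simp
  qed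
next
  case (Game a b)
  show ?case
  proof (cases d)
    case 0
    with Game.prems(1)[of "Game (Upair a b)"] show ?thesis by simp
  next
    case (Suc e)
    have "f i = Leaf i" if "e' < e" "i \<in> leaves_at e' a \<or> i \<in> leaves_at e' b" for e' i
      using Game.prems(2)[of "Suc e'" i] that Suc by auto
    moreover have "f (champion chalk u) = u" if "u \<in> nodes_at e a \<or> u \<in> nodes_at e b" for u
      using Game.prems(1)[of u] that Suc by auto
    ultimately show ?thesis using Suc Game.IH[of e] by simp
  qed
qed

text \<open>Going up from \<open>m + 1\<close>, partners drop by at least one per step, which bounds
  the sum from above; going down from \<open>n\<close> bounds it from below.\<close>

lemma decreasing_on_interval:
  fixes m n :: nat
  assumes total: "\<And>i. m < i \<Longrightarrow> i \<le> n \<Longrightarrow> \<exists>j. R i j"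
    and range: "\<And>i j. R i j \<Longrightarrow> m < i \<and> i \<le> n \<and> m < j \<and> j \<le> n"
    and decreasing: "\<And>i i' j j'. R i i' \<Longrightarrow> R j j' \<Longrightarrow> i < j \<Longrightarrow> j' < i'"
    and "R i j"
  shows "i + j = m + n + 1"
proof (rule antisym)
  have upper: "i \<le> m + k \<Longrightarrow> R i j \<Longrightarrow> i + j \<le> m + n + 1" for i j k
  proof (induction k arbitrary: i j)
    case 0
    then show ?case using range[of i j] by simp
  next
    case (Suc k)
    show ?case
    proof (cases "m < i - 1")
      case True
      then obtain j' where j': "R (i - 1) j'"
        using total[of "i - 1"] range[OF Suc.prems(2)] by (meson diff_le_self le_trans)
      have "j < j'" using decreasing[OF j' Suc.prems(2)] True by simp
      moreover have "i - 1 + j' \<le> m + n + 1" using Suc.IH[OF _ j'] Suc.prems(1) by simp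
      ultimately show ?thesis using True by linarith
    next
      case False
      then show ?thesis using range[OF Suc.prems(2)] by linarith
    qed
  qed
  show "i + j \<le> m + n + 1" using \<open>R i j\<close> upper[of i i j] by simp
  have lower: "n \<le> i + k \<Longrightarrow> R i j \<Longrightarrow> m + n + 1 \<le> i + j" for i j k
  proof (induction k arbitrary: i j)
    case 0
    then show ?case using range[of i j] by simp
  next
    case (Suc k)
    show ?case
    proof (cases "i < n")
      case True
      then obtain j' where j': "R (i + 1) j'"
        using total[of "i + 1"] range[OF Suc.prems(2)] by auto
      have "j' < j" using decreasing[OF Suc.prems(2) j'] by simp
      with Suc.IH[OF _ j'] Suc.prems(1) show ?thesis by simp
    qed (use range[OF Suc.prems(2)] in simp)
  qed
  show "m + n + 1 \<le> i + j" using \<open>R i j\<close> lower[of i n j] by simp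
qed

lemma proper_first_round:
  assumes t: "bracket_on n t" "proper t" and h: "height t = Suc d"
  obtains b m N where "first_round b m N" "t = graft (play_in m N) b"
proof -
  note bt = bracket_on_imp_is_bracket[OF t(1)]
  \<comment> \<open>\<open>m\<close> counts the teams with a bye in round 1, and \<open>R\<close>
    below is the pairing of that round.\<close>
  define m where "m = n - card (leaves_at (Suc d) t)"
  have U: "leaves_at (Suc d) t = {m<..n}"
    using proper_leaves_at_height[OF t] by (simp add: h m_def)
  have m: "m < n" using leaves_at_height_nonempty[of t] by (simp add: h U)
  define R where "R i j \<longleftrightarrow> Game (Upair (Leaf i) (Leaf j)) \<in> nodes_at d t" for i j
  have game: "\<exists>i j. p = Upair (Leaf i) (Leaf j)" if "Game p \<in> nodes_at d t" for p
  proof -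
    obtain x y where "p = Upair x y" by (cases p)
    with nodes_at_height[OF that] h show ?thesis by (auto simp: height_eq_0_iff)
  qed
  have R_commute: "R i j \<Longrightarrow> R j i" for i j
    unfolding R_def by (metis Upair_inject)
  have R_U: "i \<in> leaves_at (Suc d) t" if "R i j" for i j
    using nodes_at_add[of _ d t "Leaf i" "Suc 0"] that by (auto simp: R_def leaves_at_def)
  have R_irrefl: "\<not> R i i" for i
  proof
    assume "R i i"
    then have "{#i, i#} \<subseteq># leaves t"
      using leaves_nodes_at by (fastforce simp: R_def)
    then have "2 \<le> count (leaves t) i"
      using mset_subset_eq_count[of "{#i, i#}" "leaves t" i] by simp
    with count_leaves_bracket[OF bt, of i] show False by simp
  qed
  have R_ex: "\<exists>j. R i j" if i: "m < i" "i \<le> n" for i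
  proof -
    have "Leaf i \<in> nodes_at (Suc d) t" using i U by (auto simp: leaves_at_def)
    then obtain p where p: "Game p \<in> nodes_at d t" "Leaf i \<in> set_uprod p" by (rule nodes_at_SucE)
    with game[OF p(1)] show "\<exists>j. R i j" using R_commute by (fastforce simp: R_def)
  qed
  have sum: "i + j = m + n + 1" if "R i j" for i j
  proof (rule decreasing_on_interval[where R = R and i = i and j = j])
    fix i j assume "R i j"
    then show "m < i \<and> i \<le> n \<and> m < j \<and> j \<le> n"
      using R_U R_commute U by (metis greaterThanAtMost_iff)
  next
    \<comment> \<open>Condition (b) of properness in round 1, where nobody has lost yet, makes the
      pairing decreasing.\<close>
    fix i i' j j' assume R: "R i i'" "R j j'" "i < j"
    have "meets chalk t (Suc 0) k k'" if "R k k'" for k k'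
      unfolding meets_def h using that by (auto simp: R_def intro!: exI[of _ d])
    moreover have "i \<in># leaves t" "j \<in># leaves t"
      using R_U R leaves_at_subset by blast+
    moreover have "Suc 0 \<in> {1..height t}" by (simp add: h)
    ultimately show "j' < i'"
      using t(2) R not_lost_before_1 unfolding proper_def by blast
  qed (use R_ex that in auto)
  \<comment> \<open>The \<open>m\<close> teams with a bye and half of the \<open>n - m\<close>
    players survive round 1. Were \<open>m + n\<close> odd, the middle seed of
    \<open>{m<..n}\<close> would be its own opponent.\<close>
  define N where "N = (m + n) div 2"
  have N: "m + n = 2 * N"
  proof (rule ccontr)
    assume "m + n \<noteq> 2 * N"
    then have x: "m + n + 1 = 2 * Suc N" by (simp add: N_def)
    then obtain j where "R (Suc N) j" using R_ex[of "Suc N"] m by auto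
    with sum[OF this] x R_irrefl show False by simp
  qed
  have mN: "m < N" "N < n" "n = 2 * N - m" using N m by auto
  have not_U: "play_in m N i = Leaf i" if "i \<notin> leaves_at (Suc d) t" for i
    using that U mN by (auto simp: play_in_def)
  define b where "b = trunc d t"
  have t_eq: "graft (play_in m N) b = t"
    unfolding b_def
  proof (rule graft_trunc)
    fix u assume u: "u \<in> nodes_at d t"
    show "play_in m N (champion chalk u) = u"
    proof (cases u)
      case (Leaf i)
      then have "i \<notin> leaves_at (Suc d) t"
        using u leaves_at_unique[OF bt, of i d "Suc d"] by (auto simp: leaves_at_def)
      then show ?thesis using not_U Leaf by simp
    next
      case (Game p)
      with u game obtain i' j' where p': "p = Upair (Leaf i') (Leaf j')" by blast
      define i j where "i = min i' j'" and "j = max i' j'"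
      \<comment> \<open>Listing the higher seed first matches the form of
        \<open>play_in\<close>.\<close>
      have p: "p = Upair (Leaf i) (Leaf j)" and "i \<le> j"
        by (auto simp: p' i_def j_def min_def max_def)
      then have "R i j" using u Game by (simp add: R_def)
      with sum[OF this] N \<open>i \<le> j\<close> R_U[OF this] U
      have "m < i" "i \<le> N" "j = 2 * N + 1 - i" by auto
      then show ?thesis using \<open>i \<le> j\<close> by (auto simp: Game p play_in_def)
    qed
  next
    fix e i assume "e < d" "i \<in> leaves_at e t"
    then have "i \<notin> leaves_at (Suc d) t"
      using leaves_at_unique[OF bt, of i e "Suc d"] by auto
    then show "play_in m N i = Leaf i" by (rule not_U)
  qed
  have "first_round b m N"
  proof
    show "m < N" by (rule mN)
    have count: "count (leaves b) x +
        (if N < x \<and> x \<le> n then count (leaves b) (2 * N + 1 - x) else 0)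
      = count (mset_set {1..n}) x" for x
      using count_leaves_play_in[of m N b x] t(1) mN by (simp add: t_eq bracket_on_def)
    have mset: "count (mset_set {1..k}) x = (if 1 \<le> x \<and> x \<le> k then 1 else 0)" for k x :: nat
      by (simp add: count_mset_set')
    have low: "count (leaves b) x = (if 1 \<le> x then 1 else 0)" if "x \<le> N" for x
      using count[of x] that mN(2) unfolding mset by simp
    \<comment> \<open>For \<open>N < x \<le> n\<close> the single occurrence of \<open>x\<close> in
      \<open>t\<close> is already supplied by the game inserted at
      \<open>2 * N + 1 - x\<close>.\<close>
    have high: "count (leaves b) x = 0" if "N < x" for x
    proof (cases "x \<le> n")
      case True
      then have "2 * N + 1 - x \<le> N" "1 \<le> 2 * N + 1 - x" using that mN(3) by linarith+
      with low have "count (leaves b) (2 * N + 1 - x) = 1" by simp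
      moreover have "count (leaves b) x + count (leaves b) (2 * N + 1 - x) = 1"
        using count[of x] that True unfolding mset by simp
      ultimately show ?thesis by linarith
    next
      case False
      with count[of x] show ?thesis unfolding mset by simp
    qed
    have "leaves b = mset_set {1..N}"
    proof (rule multiset_eqI)
      fix x
      show "count (leaves b) x = count (mset_set {1..N}) x"
      proof (cases "x \<le> N")
        case True
        with low[OF this] show ?thesis unfolding mset by simp
      next
        case False
        with high[of x] show ?thesis unfolding mset by simp
      qed
    qed
    then show "bracket_on N b" using mN by (simp add: bracket_on_def)
    have hb: "height b = d" by (simp add: b_def height_trunc h)
    show "{m<..N} \<subseteq> leaves_at (height b) b"
    proof
      fix i assume i: "i \<in> {m<..N}"
      then obtain j where j: "R i j" using R_ex[of i] mN by auto
      have "champion chalk (Game (Upair (Leaf i) (Leaf j))) = i"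
        using sum[OF j] N i by simp
      with champion_in_leaves_at_trunc[of "Game (Upair (Leaf i) (Leaf j))" d t] j
      show "i \<in> leaves_at (height b) b" unfolding hb by (simp add: R_def b_def)
    qed
  qed
  then show thesis using t_eq[symmetric] by (rule that)
qed


section \<open>Existence and uniqueness\<close>

lemma bracket_height_0:
  assumes "is_bracket t" "height t = 0"
  shows "t = Leaf 1"
proof -
  obtain i where i: "t = Leaf i" using assms(2) by (auto simp: height_eq_0_iff)
  obtain n where n: "bracket_on n t" using assms(1) by (auto simp: is_bracket_def)
  then have "1 \<in># leaves t" using in_leaves_bracket_on[OF n] by (simp add: bracket_on_def)
  then show ?thesis by (simp add: i)
qed

lemma is_bracket_Leaf_1: "is_bracket (Leaf 1)"
  unfolding is_bracket_def bracket_on_def by (rule exI[of _ 1]) simp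

text \<open>The hypothesis is numerical so that it passes to the shorter list
  \<open>(y + k) # zs\<close>, whose bracket the induction then supplies.\<close>

lemma ex1_proper_of_kraft:
  assumes "horner_sum id 2 (x # xs) = 2 ^ length xs" "0 < x"
  shows "\<exists>!t. is_bracket t \<and> proper t \<and> signature t = x # xs"
  using assms
proof (induction xs arbitrary: x)
  case Nil
  then have x: "x = 1" by simp
  show ?case
  proof (rule ex1I[of _ "Leaf 1"])
    show "is_bracket (Leaf 1) \<and> proper (Leaf 1) \<and> signature (Leaf 1) = [x]"
      using is_bracket_Leaf_1 by (simp add: signature_eq proper_def x)
    fix t assume t: "is_bracket t \<and> proper t \<and> signature t = [x]"
    then have "height t = 0" using length_signature[of t] by simp
    with t show "t = Leaf 1" using bracket_height_0 by blast
  qed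
next
  case (Cons y zs)
  then have k_sum: "x + 2 * (y + 2 * horner_sum id 2 zs) = 2 * 2 ^ length zs"
    by (simp add: id_def)
  then have "even x" by presburger
  then obtain k where k: "x = 2 * k" by blast
  with k_sum Cons.prems(2) have "horner_sum id 2 ((y + k) # zs) = 2 ^ length zs" "0 < y + k"
    by (simp_all add: id_def)
  from Cons.IH[OF this] obtain b
    where b: "is_bracket b \<and> proper b \<and> signature b = (y + k) # zs"
      and uniq: "\<And>u. is_bracket u \<and> proper u \<and> signature u = (y + k) # zs \<Longrightarrow> u = b"
    unfolding Ex1_def by blast
  note b = b[THEN conjunct1] b[THEN conjunct2, THEN conjunct1] b[THEN conjunct2, THEN conjunct2]
  obtain N where N: "bracket_on N b" using b(1) by (auto simp: is_bracket_def)
  have card: "card (leaves_at (height b) b) = y + k"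
    using hd_signature[OF b(1)] b(3) by simp
  have "leaves_at (height b) b \<subseteq> {1..N}"
    using leaves_at_subset[of "height b" b] in_leaves_bracket_on[OF N] by auto
  then have kN: "y + k \<le> N" using card_mono[of "{1..N}" "leaves_at (height b) b"] card by simp
  \<comment> \<open>The \<open>k\<close> lowest seeds of \<open>b\<close> get a game; they lie among
    its \<open>y + k\<close> deepest lines, which carry the lowest seeds because \<open>b\<close> is
    proper.\<close>
  define m where "m = N - k"
  have Nm: "N - m = k" using kN by (simp add: m_def)
  interpret first_round b m N
  proof
    show "m < N" using kN k Cons.prems(2) by (simp add: m_def)
    show "{m<..N} \<subseteq> leaves_at (height b) b"
    proof -
      have "{m<..N} \<subseteq> {N - (y + k)<..N}" by (auto simp: m_def)
      also have "\<dots> = leaves_at (height b) b"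
        using proper_leaves_at_height[OF N b(2)] unfolding card by (rule sym)
      finally show ?thesis .
    qed
  qed (rule N)
  show ?case
  proof (rule ex1I[of _ t])
    have "signature t = x # y # zs"
      unfolding signature_t Nm b(3) k by simp
    then show "is_bracket t \<and> proper t \<and> signature t = x # y # zs"
      using is_bracket_t proper_iff b(2) by blast
    fix u assume u: "is_bracket u \<and> proper u \<and> signature u = x # y # zs"
    then obtain n where n: "bracket_on n u" by (auto simp: is_bracket_def)
    have "height u = Suc (length zs)" using length_signature[of u] u by simp
    from proper_first_round[OF n _ this] u obtain b' m' N'
      where b': "first_round b' m' N'" "u = graft (play_in m' N') b'" by blast
    interpret u: first_round b' m' N' by (rule b'(1))
    have sig: "2 * (N' - m') = x" "hd (signature b') - (N' - m') = y" "tl (signature b') = zs"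
      using u u.signature_t unfolding b'(2) by simp_all
    \<comment> \<open>The peeled signature of any competitor is forced, so \<open>b'\<close> is
      \<open>b\<close>; the number of teams then fixes \<open>N'\<close>, and \<open>x\<close> fixes
      \<open>m'\<close>.\<close>
    have "signature b' \<noteq> []" using length_signature[of b'] by auto
    then have "signature b' = (y + k) # zs"
      using sig u.le_hd_signature k by (cases "signature b'") auto
    then have eq: "b' = b"
      using uniq u.is_bracket_b u.proper_iff u b'(2) by blast
    then have "N' = N" using bracket_on_unique u.bracket N by blast
    moreover from this have "m' = m" using sig(1) k Nm u.m_less m_less by simp
    ultimately show "u = t" using b'(2) eq by simp
  qed
qed

theorem theorem2p2p16:
  fixes a :: "nat list"
  assumes "bracket_signature a"
  shows "\<exists>!t. is_bracket t \<and> proper t \<and> signature t = a"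
proof -
  obtain t where t: "is_bracket t" "signature t = a"
    using assms by (auto simp: bracket_signature_def)
  obtain x xs where a: "a = x # xs" using length_signature[of t] t(2) by (cases a) auto
  have "length xs = height t" using length_signature[of t] by (simp add: t(2) a)
  then have "horner_sum id 2 (x # xs) = 2 ^ length xs"
    using kraft_signature[OF t(1)] t(2) a by simp
  \<comment> \<open>Some starting line has maximal depth.\<close>
  moreover have "0 < x"
    using hd_signature[OF t(1)] leaves_at_height_nonempty[of t] t(2) a
    by (simp add: card_gt_0_iff)
  ultimately show ?thesis unfolding a by (rule ex1_proper_of_kraft)
qed

end
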